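(* The function $r:\mathbb R^{2\times2}\to\mathbb R$ defined by $r(\mathbf H)=g_q(\sigma_1(\mathbf H))+g_q(\sigma_2(\mathbf H))$, where $\sigma_1(\mathbf H),\sigma_2(\mathbf H)$ are the singular values of $\mathbf H\in\mathbb R^{2\times2}$, is restricted proximal regular.
   Context: Shrinkage penalty. Fix $\rho>0$ and $q\in(0,1)$. Let $s_q(x)=\max\{|x|-\rho^{2-q}|x|^{q-1},0\}\,\mathrm{sign}(x)$ (with $s_q(0)=0$). The function $g_q:\mathbb R\to\mathbb R$ is the even continuous function, strictly increasing on $[0,\infty)$ and differentiable on $(0,\infty)$, normalized by $g_q(0)=0$, whose proximal map is $s_q$, i.e. $s_q(x)=\arg\min_t\{\rho g_q(t)+\frac12(t-x)^2\}$ for all $x\in\mathbb R$. For $q\in(0,1)$ it is coercive and $g_q''<0$ on $(0,\infty)$. Restricted proximal regularity. A lower semicontinuous function $f:\mathbb R^n\to\mathbb R\cup\{\infty\}$ is restricted proximal regular if for any $M>0$ and any bounded set $\Omega$ there exists $\gamma=\gamma(M,\Omega)$ such that for all $y\in\Omega$, all $x\in\{x\in\Omega:\ \|p\|\le M\ \ \forall p\in\partial f(x)\}$, and all $d\in\partial f(x)$, $$f(y)-f(x)-\langle d,y-x\rangle\ge-\frac\gamma2\|y-x\|^2.$$ Here $\partial f$ is the (limiting) subdifferential, and $\mathbb R^{2\times2}$ is identified with $\mathbb R^4$ with the Frobenius inner product and norm. *)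

theory Defs
  imports "HOL-Analysis.Analysis" "HOL-Computational_Algebra.Polynomial"
begin

definition charpoly :: "real ^ 'n ^ 'n \<Rightarrow> real poly" where
  "charpoly A = det (\<chi> i j. if i = j then [:- (A $ i $ j), 1:] else [:- (A $ i $ j):])"

text \<open>Singular values are counted with multiplicity: the roots of the characteristic polynomial of
  \<open>H\<^sup>T H\<close> are all real, so the multiset below has exactly \<open>CARD('n)\<close> elements.\<close>

definition singular_values :: "real ^ 'n ^ 'n \<Rightarrow> real multiset" where
  "singular_values H = image_mset sqrt (proots (charpoly (transpose H ** H)))"

text \<open>The \<open>k\<close>-th largest singular value, for \<open>k = 1, \<dots>, CARD('n)\<close>.\<close>

definition singular_value :: "nat \<Rightarrow> real ^ 'n ^ 'n \<Rightarrow> real" where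
  "singular_value k H = rev (sorted_list_of_multiset (singular_values H)) ! (k - 1)"

definition shrinkage :: "real \<Rightarrow> real \<Rightarrow> real \<Rightarrow> real" where
  "shrinkage \<rho> q x = max (\<bar>x\<bar> - \<rho> powr (2 - q) * \<bar>x\<bar> powr (q - 1)) 0 * sgn x"

text \<open>The listed properties determine \<open>g\<close> uniquely for \<open>\<rho> > 0\<close> and \<open>0 < q < 1\<close>: on
  \<open>(0, \<infinity>)\<close> the last one forces \<open>g'(shrinkage \<rho> q x) = \<rho> powr (1 - q) * x powr (q - 1)\<close>
  for all \<open>x > \<rho>\<close>.\<close>

definition is_shrinkage_penalty :: "real \<Rightarrow> real \<Rightarrow> (real \<Rightarrow> real) \<Rightarrow> bool" where
  "is_shrinkage_penalty \<rho> q g \<longleftrightarrow>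
     (\<forall>t. g (- t) = g t) \<and>
     continuous_on UNIV g \<and>
     strict_mono_on {0..} g \<and>
     (\<forall>t>0. g differentiable (at t)) \<and>
     g 0 = 0 \<and>
     (\<forall>x. {t. is_arg_min (\<lambda>t. \<rho> * g t + 1 / 2 * (t - x)\<^sup>2) (\<lambda>_. True) t} = {shrinkage \<rho> q x})"

definition lower_semicontinuous :: "('a::topological_space \<Rightarrow> ereal) \<Rightarrow> bool" where
  "lower_semicontinuous f \<longleftrightarrow> (\<forall>x. f x \<le> Liminf (at x) f)"

definition regular_subdifferential :: "('a::euclidean_space \<Rightarrow> ereal) \<Rightarrow> 'a \<Rightarrow> 'a set" where
  "regular_subdifferential f x =
     {d. \<bar>f x\<bar> \<noteq> \<infinity> \<and>
         0 \<le> Liminf (at x) (\<lambda>y. (f y - f x - ereal (d \<bullet> (y - x))) / ereal (norm (y - x)))}"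

definition limiting_subdifferential :: "('a::euclidean_space \<Rightarrow> ereal) \<Rightarrow> 'a \<Rightarrow> 'a set" where
  "limiting_subdifferential f x =
     {d. \<bar>f x\<bar> \<noteq> \<infinity> \<and>
         (\<exists>X D. X \<longlonglongrightarrow> x \<and> (\<lambda>k. f (X k)) \<longlonglongrightarrow> f x \<and>
                (\<forall>k. D k \<in> regular_subdifferential f (X k)) \<and> D \<longlonglongrightarrow> d)}"

text \<open>Functions into \<open>\<real> \<union> {\<infinity>}\<close> are \<open>ereal\<close>-valued functions that avoid \<open>- \<infinity>\<close>.\<close>

definition restricted_proximal_regular :: "('a::euclidean_space \<Rightarrow> ereal) \<Rightarrow> bool" where
  "restricted_proximal_regular f \<longleftrightarrow>
     (\<forall>x. f x \<noteq> - \<infinity>) \<and> lower_semicontinuous f \<and>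
     (\<forall>M>0. \<forall>\<Omega>. bounded \<Omega> \<longrightarrow>
        (\<exists>\<gamma>::real. \<forall>y\<in>\<Omega>. \<forall>x\<in>{x\<in>\<Omega>. \<forall>p\<in>limiting_subdifferential f x. norm p \<le> M}.
           \<forall>d\<in>limiting_subdifferential f x.
             f y - f x - ereal (d \<bullet> (y - x)) \<ge> ereal (- (\<gamma> / 2) * (norm (y - x))\<^sup>2)))"

end

(* A real 2x2 matrix acts on the complex plane as z |-> (p z + q cnj z) / 2 with p, q linear in the
   matrix, and its singular values are (|p| + |q|) / 2 and ||p| - |q|| / 2.  Since the shrinkage
   operator is onto, the proximal condition gives phi(t) = rho g(t) + t^2 / 2 a supporting line at
   every point, so phi is convex.  Then phi((u + v) / 2) + phi((u - v) / 2) is convex and even in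
   each of u and v, hence increasing for u, v >= 0, and substituting u = |p|, v = |q| shows that
   rho r(H) + |H|^2 / 2 is convex in H.  For a function that becomes convex after adding a multiple
   of the squared norm, the proximal inequality holds globally with one constant. *)

theory Submission
  imports Defs
begin

subsection \<open>Weakly convex functions\<close>

text \<open>Averaging the supporting line at a convex combination over the two endpoints cancels its
  slope term and leaves the convexity inequality.\<close>

lemma convex_on_UNIV_if_supported:
  fixes f :: "real \<Rightarrow> real"
  assumes "\<And>z. \<exists>m. \<forall>u. f z + m * (u - z) \<le> f u"
  shows "convex_on UNIV f"
proof (rule convex_onI)
  fix t x y :: real
  assume t: "0 < t" "t < 1"
  define z where "z = (1 - t) * x + t * y"
  obtain m where m: "\<And>u. f z + m * (u - z) \<le> f u"
    using assms by blast
  have "(1 - t) * (f z + m * (x - z)) + t * (f z + m * (y - z)) \<le> (1 - t) * f x + t * f y"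
    using m t by (intro add_mono mult_left_mono) auto
  moreover have "(1 - t) * (f z + m * (x - z)) + t * (f z + m * (y - z)) = f z"
    by (simp add: z_def algebra_simps)
  ultimately show "f ((1 - t) *\<^sub>R x + t *\<^sub>R y) \<le> (1 - t) * f x + t * f y"
    by (simp add: z_def)
qed simp

text \<open>A regular subgradient controls \<open>f\<close> only to first order near
  \<open>x\<close>. Convexity of \<open>h\<close> along the segment from \<open>x\<close> to
  \<open>y\<close> carries this control to the far endpoint, with an error \<open>e\<close> that is
  sent to zero at the end.\<close>

lemma regular_subgradient_weakly_convex:
  fixes f :: "'a::euclidean_space \<Rightarrow> real"
  assumes c: "0 \<le> c"
    and conv: "convex_on UNIV (\<lambda>x. f x + c / 2 * (norm x)\<^sup>2)"
    and d: "d \<in> regular_subdifferential (\<lambda>x. ereal (f x)) x"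
  shows "- (c / 2) * (norm (y - x))\<^sup>2 \<le> f y - f x - d \<bullet> (y - x)"
proof (cases "y = x")
  case False
  define v where "v = y - x"
  have v: "norm v > 0" using False by (simp add: v_def)
  define h where "h = (\<lambda>x. f x + c / 2 * (norm x)\<^sup>2)"
  have approx: "d \<bullet> v - e * norm v \<le> h y - h x - c * (x \<bullet> v)" if e: "e > 0" for e
  proof -
    have "ereal (- e) < 0" using e by simp
    also have "0 \<le> Liminf (at x) (\<lambda>y. (ereal (f y) - ereal (f x) - ereal (d \<bullet> (y - x))) / ereal (norm (y - x)))"
      using d by (simp add: regular_subdifferential_def)
    finally have "\<forall>\<^sub>F z in at x.
        ereal (- e) < (ereal (f z) - ereal (f x) - ereal (d \<bullet> (z - x))) / ereal (norm (z - x))"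
      by (rule less_LiminfD)
    then obtain \<delta> where \<delta>: "\<delta> > 0"
      and near: "\<And>z. z \<noteq> x \<Longrightarrow> dist z x < \<delta> \<Longrightarrow>
        ereal (- e) < (ereal (f z) - ereal (f x) - ereal (d \<bullet> (z - x))) / ereal (norm (z - x))"
      unfolding eventually_at by blast
    \<comment> \<open>The bound \<open>1 / 2\<close> keeps the point inside the segment; the other
      bound keeps it within \<delta> of \<open>x\<close>.\<close>
    define t where "t = min (1 / 2) (\<delta> / (2 * norm v))"
    have t: "0 < t" "t < 1" using \<delta> v by (auto simp: t_def)
    have "t * norm v \<le> \<delta> / (2 * norm v) * norm v"
      using v by (intro mult_right_mono) (auto simp: t_def)
    then have tv: "t * norm v < \<delta>" using \<delta> v by simp
    define z where "z = x + t *\<^sub>R v"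
    have zx: "z - x = t *\<^sub>R v" "norm (z - x) = t * norm v"
      using t by (simp_all add: z_def)
    have "z \<noteq> x" "dist z x < \<delta>"
      using t v tv by (auto simp: z_def dist_norm)
    from near[OF this] have "- e < (f z - f x - d \<bullet> (z - x)) / norm (z - x)"
      using t v by (simp add: zx)
    then have lower: "- (e * (t * norm v)) < f z - f x - t * (d \<bullet> v)"
      using t v by (simp add: zx pos_less_divide_eq)
    have "h ((1 - t) *\<^sub>R x + t *\<^sub>R y) \<le> (1 - t) * h x + t * h y"
      using convex_onD[OF conv] t unfolding h_def by simp
    then have "h z \<le> (1 - t) * h x + t * h y"
      by (simp add: z_def v_def algebra_simps)
    moreover have "(norm z)\<^sup>2 = (norm x)\<^sup>2 + 2 * t * (x \<bullet> v) + t\<^sup>2 * (norm v)\<^sup>2"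
      unfolding z_def power2_norm_eq_inner
      by (simp add: inner_simps inner_commute power2_eq_square algebra_simps)
    ultimately have "f z - f x \<le> t * (h y - h x)
        - c / 2 * (2 * t * (x \<bullet> v) + t\<^sup>2 * (norm v)\<^sup>2)"
      by (simp add: h_def field_simps)
    \<comment> \<open>The discarded term is quadratic in \<open>t\<close> and has a favourable sign
      because \<open>0 \<le> c\<close>; what remains is linear in \<open>t\<close>, so
      \<open>t\<close> can be cancelled.\<close>
    also have "\<dots> \<le> t * (h y - h x - c * (x \<bullet> v))"
      using c by (simp add: algebra_simps)
    finally have "t * (d \<bullet> v - e * norm v) \<le> t * (h y - h x - c * (x \<bullet> v))"
      using lower by (simp add: algebra_simps)
    then show ?thesis using t by simp
  qed
  have "d \<bullet> v \<le> h y - h x - c * (x \<bullet> v)"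
  proof (rule field_le_epsilon)
    fix e :: real assume "e > 0"
    then show "d \<bullet> v \<le> h y - h x - c * (x \<bullet> v) + e"
      using approx[of "e / norm v"] v by simp
  qed
  moreover have "(norm y)\<^sup>2 = (norm x)\<^sup>2 + 2 * (x \<bullet> v) + (norm v)\<^sup>2"
    unfolding v_def power2_norm_eq_inner by (simp add: inner_simps inner_commute)
  ultimately show ?thesis
    by (simp add: h_def v_def[symmetric] field_simps)
qed simp

text \<open>The inequality for regular subgradients is closed under the limits that define limiting
  ones. The constant \<open>c\<close> serves as \<gamma> for every \<open>M\<close> and
  \<Omega>.\<close>

lemma weakly_convex_imp_restricted_proximal_regular:
  fixes f :: "'a::euclidean_space \<Rightarrow> real"
  assumes c: "0 \<le> c"
    and conv: "convex_on UNIV (\<lambda>x. f x + c / 2 * (norm x)\<^sup>2)"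
  shows "restricted_proximal_regular (\<lambda>x. ereal (f x))"
proof -
  \<comment> \<open>A finite convex function on a Euclidean space is continuous; subtracting the
    quadratic gives continuity of \<open>f\<close>, hence lower semicontinuity.\<close>
  have "continuous_on UNIV (\<lambda>x. (f x + c / 2 * (norm x)\<^sup>2) - c / 2 * (norm x)\<^sup>2)"
    by (intro continuous_intros convex_on_continuous conv) auto
  then have cont: "isCont f x" for x
    by (simp add: continuous_on_eq_continuous_at)
  have "ereal (f x) \<le> Liminf (at x) (\<lambda>x. ereal (f x))" for x
    using cont[of x] by (subst lim_imp_Liminf[of "at x" _ "ereal (f x)"]) (auto simp: isCont_def)
  then have lsc: "lower_semicontinuous (\<lambda>x. ereal (f x))"
    by (simp add: lower_semicontinuous_def)
  have "- (c / 2) * (norm (y - x))\<^sup>2 \<le> f y - f x - d \<bullet> (y - x)"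
    if "d \<in> limiting_subdifferential (\<lambda>x. ereal (f x)) x" for x y d
  proof -
    obtain X D where X: "X \<longlonglongrightarrow> x" and fX: "(\<lambda>k. f (X k)) \<longlonglongrightarrow> f x"
      and D: "\<And>k. D k \<in> regular_subdifferential (\<lambda>x. ereal (f x)) (X k)" "D \<longlonglongrightarrow> d"
      using \<open>d \<in> _\<close> by (auto simp: limiting_subdifferential_def)
    show ?thesis
    proof (rule LIMSEQ_le)
      show "(\<lambda>k. - (c / 2) * (norm (y - X k))\<^sup>2) \<longlonglongrightarrow> - (c / 2) * (norm (y - x))\<^sup>2"
        by (intro tendsto_intros X)
      show "(\<lambda>k. f y - f (X k) - D k \<bullet> (y - X k)) \<longlonglongrightarrow> f y - f x - d \<bullet> (y - x)"
        by (intro tendsto_intros X fX D)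
      show "\<exists>N. \<forall>k\<ge>N. - (c / 2) * (norm (y - X k))\<^sup>2 \<le> f y - f (X k) - D k \<bullet> (y - X k)"
        using regular_subgradient_weakly_convex[OF c conv D(1)] by blast
    qed
  qed
  then show ?thesis
    using lsc unfolding restricted_proximal_regular_def by (auto intro!: exI[of _ c])
qed

subsection \<open>Singular values of \<open>2 \<times> 2\<close> matrices\<close>

text \<open>Twice the coefficient of \<open>z\<close> when \<open>H\<close> acts on columns
  \<open>(Re z, Im z)\<close>; \<open>anticonformal_part\<close> is twice that of
  \<open>cnj z\<close>.\<close>

definition conformal_part :: "real ^ 2 ^ 2 \<Rightarrow> complex" where
  "conformal_part H = Complex (H $ 1 $ 1 + H $ 2 $ 2) (H $ 2 $ 1 - H $ 1 $ 2)"

definition anticonformal_part :: "real ^ 2 ^ 2 \<Rightarrow> complex" where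
  "anticonformal_part H = Complex (H $ 1 $ 1 - H $ 2 $ 2) (H $ 2 $ 1 + H $ 1 $ 2)"

lemma linear_conformal_part: "linear conformal_part"
  by (rule linearI) (simp_all add: conformal_part_def complex_eq_iff algebra_simps)

lemma linear_anticonformal_part: "linear anticonformal_part"
  by (rule linearI) (simp_all add: anticonformal_part_def complex_eq_iff algebra_simps)

text \<open>The squares \<open>a\<close> and \<open>b\<close> of the claimed values have the trace
  of \<open>transpose H ** H\<close> as sum and its determinant as product, so they are the two
  roots of its characteristic polynomial.\<close>

lemma singular_values_2:
  fixes H :: "real ^ 2 ^ 2"
  defines "u \<equiv> cmod (conformal_part H)" and "v \<equiv> cmod (anticonformal_part H)"
  shows "singular_values H = {# (u + v) / 2, \<bar>u - v\<bar> / 2 #}"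
proof -
  define a b where "a = ((u + v) / 2)\<^sup>2" and "b = ((u - v) / 2)\<^sup>2"
  have u2: "u\<^sup>2 = (H $ 1 $ 1 + H $ 2 $ 2)\<^sup>2 + (H $ 2 $ 1 - H $ 1 $ 2)\<^sup>2"
    by (simp add: u_def conformal_part_def cmod_power2)
  have v2: "v\<^sup>2 = (H $ 1 $ 1 - H $ 2 $ 2)\<^sup>2 + (H $ 2 $ 1 + H $ 1 $ 2)\<^sup>2"
    by (simp add: v_def anticonformal_part_def cmod_power2)
  have "a + b = (u\<^sup>2 + v\<^sup>2) / 2"
    by (simp add: a_def b_def power2_eq_square field_simps)
  also have "\<dots> = (H $ 1 $ 1)\<^sup>2 + (H $ 1 $ 2)\<^sup>2 + (H $ 2 $ 1)\<^sup>2 + (H $ 2 $ 2)\<^sup>2"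
    unfolding u2 v2 by (simp add: power2_eq_square field_simps)
  finally have sum: "a + b = \<dots>" .
  have "a * b = ((u\<^sup>2 - v\<^sup>2) / 4)\<^sup>2"
    by (simp add: a_def b_def power2_eq_square field_simps)
  \<comment> \<open>This quantity is the determinant of \<open>H\<close>.\<close>
  also have "(u\<^sup>2 - v\<^sup>2) / 4 = H $ 1 $ 1 * H $ 2 $ 2 - H $ 1 $ 2 * H $ 2 $ 1"
    unfolding u2 v2 by (simp add: power2_eq_square field_simps)
  finally have prod: "a * b = (H $ 1 $ 1 * H $ 2 $ 2 - H $ 1 $ 2 * H $ 2 $ 1)\<^sup>2" .
  have "charpoly (transpose H ** H) = [:a * b, - (a + b), 1:]"
    unfolding sum prod
    by (simp add: charpoly_def det_2 matrix_matrix_mult_def transpose_def sum_2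
        power2_eq_square algebra_simps)
  also have "\<dots> = [:- a, 1:] * [:- b, 1:]"
    by simp
  also have "proots \<dots> = {#a, b#}"
    by (subst proots_mult) auto
  finally have "proots (charpoly (transpose H ** H)) = {#a, b#}" .
  moreover have "sqrt a = (u + v) / 2" "sqrt b = \<bar>u - v\<bar> / 2"
    by (simp_all add: a_def b_def u_def v_def)
  ultimately show ?thesis
    by (simp only: singular_values_def image_mset_add_mset image_mset_empty)
qed

lemma singular_value_2:
  fixes H :: "real ^ 2 ^ 2"
  defines "u \<equiv> cmod (conformal_part H)" and "v \<equiv> cmod (anticonformal_part H)"
  shows "singular_value 1 H = (u + v) / 2" "singular_value 2 H = \<bar>u - v\<bar> / 2"
proof -
  have "0 \<le> u" "0 \<le> v"
    by (simp_all add: u_def v_def)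
  then have "\<bar>u - v\<bar> / 2 \<le> (u + v) / 2"
    by auto
  moreover have "singular_values H = mset [\<bar>u - v\<bar> / 2, (u + v) / 2]"
    unfolding u_def v_def by (simp add: singular_values_2)
  ultimately have "sorted_list_of_multiset (singular_values H) = [\<bar>u - v\<bar> / 2, (u + v) / 2]"
    by (simp only: sorted_list_of_multiset_mset) simp
  then show "singular_value 1 H = (u + v) / 2" "singular_value 2 H = \<bar>u - v\<bar> / 2"
    by (simp_all add: singular_value_def)
qed

lemma power2_norm_eq_conformal_parts:
  fixes H :: "real ^ 2 ^ 2"
  shows "(norm H)\<^sup>2 = ((cmod (conformal_part H))\<^sup>2 + (cmod (anticonformal_part H))\<^sup>2) / 2"
proof -
  have "(norm H)\<^sup>2 = (H $ 1 $ 1)\<^sup>2 + (H $ 1 $ 2)\<^sup>2 + (H $ 2 $ 1)\<^sup>2 + (H $ 2 $ 2)\<^sup>2"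
    unfolding power2_norm_eq_inner by (simp add: inner_vec_def sum_2 power2_eq_square)
  also have "\<dots> = ((cmod (conformal_part H))\<^sup>2 + (cmod (anticonformal_part H))\<^sup>2) / 2"
    unfolding cmod_power2 conformal_part_def anticonformal_part_def
    by (simp add: power2_eq_square field_simps)
  finally show ?thesis .
qed

subsection \<open>Convex even functions of singular values\<close>

text \<open>The point \<open>x\<close> lies between \<open>- y\<close> and \<open>y\<close>, where
  \<open>f\<close> takes equal values.\<close>

lemma convex_even_mono:
  fixes f :: "real \<Rightarrow> real"
  assumes conv: "convex_on UNIV f" and even: "\<And>t. f (- t) = f t" and "0 \<le> x" "x \<le> y"
  shows "f x \<le> f y"
proof (cases "y = 0")
  case False
  then have y: "y > 0" using assms by simp
  \<comment> \<open>The solution of \<open>(1 - t) * y - t * y = x\<close>.\<close>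
  define t where "t = (y - x) / (2 * y)"
  have "0 \<le> t" "t \<le> 1" using assms y by (auto simp: t_def field_simps)
  then have "f ((1 - t) *\<^sub>R y + t *\<^sub>R (- y)) \<le> (1 - t) * f y + t * f (- y)"
    using convex_onD[OF conv] by blast
  moreover have "(1 - t) *\<^sub>R y + t *\<^sub>R (- y) = x"
    using y by (simp add: t_def field_simps)
  moreover have "(1 - t) * f y + t * f (- y) = f y"
    by (simp add: even algebra_simps)
  ultimately show ?thesis
    by simp
qed (use assms in simp)

lemma convex_on_singular_values:
  fixes \<phi> :: "real \<Rightarrow> real"
  assumes conv: "convex_on UNIV \<phi>" and even: "\<And>t. \<phi> (- t) = \<phi> t"
  shows "convex_on UNIV (\<lambda>H :: real ^ 2 ^ 2. \<phi> (singular_value 1 H) + \<phi> (singular_value 2 H))"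
proof -
  \<comment> \<open>Omitting the absolute value around \<open>u - v\<close> is harmless for even
    \<phi> and makes \<open>F\<close> jointly convex, as \<phi> is composed with linear
    maps.\<close>
  define F where "F u v = \<phi> ((u + v) / 2) + \<phi> ((u - v) / 2)" for u v
  have F_convex: "F ((1 - t) * u + t * u') ((1 - t) * v + t * v') \<le> (1 - t) * F u v + t * F u' v'"
    if "0 \<le> t" "t \<le> 1" for t u u' v v'
  proof -
    have ineq: "\<phi> ((1 - t) *\<^sub>R ((u + v) / 2) + t *\<^sub>R ((u' + v') / 2))
        \<le> (1 - t) * \<phi> ((u + v) / 2) + t * \<phi> ((u' + v') / 2)"
      "\<phi> ((1 - t) *\<^sub>R ((u - v) / 2) + t *\<^sub>R ((u' - v') / 2))
        \<le> (1 - t) * \<phi> ((u - v) / 2) + t * \<phi> ((u' - v') / 2)"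
      using convex_onD[OF conv] that by blast+
    have eq: "(1 - t) *\<^sub>R ((u + v) / 2) + t *\<^sub>R ((u' + v') / 2)
        = (((1 - t) * u + t * u') + ((1 - t) * v + t * v')) / 2"
      "(1 - t) *\<^sub>R ((u - v) / 2) + t *\<^sub>R ((u' - v') / 2)
        = (((1 - t) * u + t * u') - ((1 - t) * v + t * v')) / 2"
      by (simp_all add: field_simps)
    show ?thesis
      using ineq unfolding eq F_def distrib_left by linarith
  qed
  have even_diff: "\<phi> ((b - a) / 2) = \<phi> ((a - b) / 2)" for a b
    using even[of "(a - b) / 2"] by (simp only: minus_divide_left minus_diff_eq)
  have F_commute: "F u v = F v u" for u v
    using even_diff[of u v] by (simp add: F_def add.commute)
  have F_even: "F (- u) v = F u v" for u v
    using even_diff[of u v] even_diff[of "- u" v] by (simp add: F_def add.commute)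
  have F_mono1: "F u v \<le> F u' v" if "0 \<le> u" "u \<le> u'" for u u' v
  proof (rule convex_even_mono[where f = "\<lambda>u. F u v", OF _ F_even that])
    show "convex_on UNIV (\<lambda>u. F u v)"
    proof (rule convex_onI)
      fix t x y :: real
      assume "0 < t" "t < 1"
      moreover have "(1 - t) * v + t * v = v"
        by (simp add: algebra_simps)
      ultimately show "F ((1 - t) *\<^sub>R x + t *\<^sub>R y) v \<le> (1 - t) * F x v + t * F y v"
        using F_convex[of t x y v v] by simp
    qed simp
  qed
  have F_mono: "F u v \<le> F u' v'" if "0 \<le> u" "u \<le> u'" "0 \<le> v" "v \<le> v'" for u u' v v'
    using F_mono1[OF that(1,2), of v] F_mono1[OF that(3,4), of u'] by (simp add: F_commute)
  have F_eq: "\<phi> (singular_value 1 H) + \<phi> (singular_value 2 H)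
      = F (cmod (conformal_part H)) (cmod (anticonformal_part H))" for H
    using even_diff[of "cmod (conformal_part H)" "cmod (anticonformal_part H)"]
    by (cases "cmod (anticonformal_part H) \<le> cmod (conformal_part H)")
      (simp_all only: F_def singular_value_2 abs_of_nonneg abs_of_neg diff_ge_0_iff_ge diff_less_0_iff_less not_le minus_diff_eq)
  have subadd: "norm (L ((1 - t) *\<^sub>R A + t *\<^sub>R B)) \<le> (1 - t) * norm (L A) + t * norm (L B)"
    if "linear L" "0 < t" "t < 1" for L :: "real ^ 2 ^ 2 \<Rightarrow> complex" and A B t
    using norm_triangle_ineq[of "(1 - t) *\<^sub>R L A" "t *\<^sub>R L B"] that
    by (simp add: linear_add linear_scale)
  show ?thesis
    unfolding F_eq
  proof (rule convex_onI)
    fix t :: real and A B :: "real ^ 2 ^ 2"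
    assume t: "0 < t" "t < 1"
    let ?C = "(1 - t) *\<^sub>R A + t *\<^sub>R B"
    have "F (cmod (conformal_part ?C)) (cmod (anticonformal_part ?C))
        \<le> F ((1 - t) * cmod (conformal_part A) + t * cmod (conformal_part B))
            ((1 - t) * cmod (anticonformal_part A) + t * cmod (anticonformal_part B))"
      \<comment> \<open>Both norms are convex in the matrix, and monotonicity of \<open>F\<close> on
        nonnegative arguments preserves the inequalities.\<close>
      by (intro F_mono subadd linear_conformal_part linear_anticonformal_part t) auto
    also have "\<dots> \<le> (1 - t) * F (cmod (conformal_part A)) (cmod (anticonformal_part A))
        + t * F (cmod (conformal_part B)) (cmod (anticonformal_part B))"
      using t by (intro F_convex) auto
    finally show "F (cmod (conformal_part ?C)) (cmod (anticonformal_part ?C))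
        \<le> (1 - t) * F (cmod (conformal_part A)) (cmod (anticonformal_part A))
        + t * F (cmod (conformal_part B)) (cmod (anticonformal_part B))" .
  qed simp
qed

subsection \<open>The shrinkage penalty\<close>

text \<open>The intermediate value theorem on \<open>{\<rho>..t + \<rho>}\<close> reaches every
  \<open>t \<ge> 0\<close>; oddness gives the negative values.\<close>

lemma surj_shrinkage:
  assumes \<rho>: "\<rho> > 0" and q: "q < 1"
  shows "surj (shrinkage \<rho> q)"
proof -
  define k where "k x = x - \<rho> powr (2 - q) * x powr (q - 1)" for x
  have k0: "k \<rho> = 0"
    using \<rho> by (simp add: k_def flip: powr_add)
  have nonneg: "\<exists>x. shrinkage \<rho> q x = t" if t: "t \<ge> 0" for t
  proof -
    \<comment> \<open>Since \<open>q - 1\<close> is negative, the amount subtracted at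
      \<open>t + \<rho>\<close> is at most the amount subtracted at \<rho>, which is \<rho>
      itself.\<close>
    have "(t + \<rho>) powr (q - 1) \<le> \<rho> powr (q - 1)"
      using q \<rho> t by (intro powr_mono2') auto
    then have "\<rho> powr (2 - q) * (t + \<rho>) powr (q - 1) \<le> \<rho> powr (2 - q) * \<rho> powr (q - 1)"
      by (intro mult_left_mono) auto
    then have "t \<le> k (t + \<rho>)"
      using \<rho> by (simp add: k_def flip: powr_add)
    moreover have "continuous_on {\<rho>..t + \<rho>} k"
      unfolding k_def using \<rho> by (intro continuous_intros) auto
    ultimately obtain x where "\<rho> \<le> x" "k x = t"
      using IVT'[of k \<rho> t "t + \<rho>"] k0 t by auto
    then have "shrinkage \<rho> q x = t"
      using \<rho> t by (simp add: shrinkage_def k_def)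
    then show ?thesis ..
  qed
  have odd: "shrinkage \<rho> q (- x) = - shrinkage \<rho> q x" for x
    by (simp add: shrinkage_def sgn_minus)
  have "\<exists>x. shrinkage \<rho> q x = t" for t
  proof (cases "t \<ge> 0")
    case False
    then obtain x where "shrinkage \<rho> q x = - t"
      using nonneg[of "- t"] by auto
    then have "shrinkage \<rho> q (- x) = t"
      by (simp add: odd)
    then show ?thesis ..
  qed (rule nonneg)
  then show ?thesis
    by (metis surjI)
qed

lemma shrinkage_penalty_convex:
  assumes \<rho>: "\<rho> > 0" and q: "q < 1" and g: "is_shrinkage_penalty \<rho> q g"
  shows "convex_on UNIV (\<lambda>t. \<rho> * g t + t\<^sup>2 / 2)"
proof (rule convex_on_UNIV_if_supported)
  fix z
  obtain x where x: "z = shrinkage \<rho> q x"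
    using surj_shrinkage[OF \<rho> q] by (metis surjD)
  have "z \<in> {t. is_arg_min (\<lambda>t. \<rho> * g t + 1 / 2 * (t - x)\<^sup>2) (\<lambda>_. True) t}"
    using g unfolding is_shrinkage_penalty_def x by simp
  then have "\<rho> * g z + 1 / 2 * (z - x)\<^sup>2 \<le> \<rho> * g u + 1 / 2 * (u - x)\<^sup>2" for u
    by (simp add: is_arg_min_def not_less)
  \<comment> \<open>Expanding the squares cancels the terms in \<open>x\<close> alone, so the source
    point \<open>x\<close> becomes the slope of the supporting line at \<open>z\<close>.\<close>
  then have "\<forall>u. \<rho> * g z + z\<^sup>2 / 2 + x * (u - z) \<le> \<rho> * g u + u\<^sup>2 / 2"
    by (simp add: power2_eq_square algebra_simps)
  then show "\<exists>m. \<forall>u. \<rho> * g z + z\<^sup>2 / 2 + m * (u - z) \<le> \<rho> * g u + u\<^sup>2 / 2" ..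
qed

theorem proposition2:
  fixes \<rho> q :: real and g :: "real \<Rightarrow> real" and r :: "real ^ 2 ^ 2 \<Rightarrow> real"
  assumes "\<rho> > 0" and "0 < q" and "q < 1"
    and "is_shrinkage_penalty \<rho> q g"
    and "\<And>H. r H = g (singular_value 1 H) + g (singular_value 2 H)"
  shows "restricted_proximal_regular (\<lambda>H. ereal (r H))"
proof (rule weakly_convex_imp_restricted_proximal_regular)
  \<comment> \<open>The modulus \<open>1 / \<rho>\<close> arises from dividing the convex function
    built from \<phi> by \<rho>, so that \<open>r\<close> appears with coefficient one.\<close>
  show "0 \<le> 1 / \<rho>"
    using assms by simp
  define \<phi> where "\<phi> t = \<rho> * g t + t\<^sup>2 / 2" for t
  have "g (- t) = g t" for t
    using assms unfolding is_shrinkage_penalty_def by blast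
  then have "\<phi> (- t) = \<phi> t" for t
    by (simp add: \<phi>_def)
  moreover have "convex_on UNIV \<phi>"
    unfolding \<phi>_def using assms by (intro shrinkage_penalty_convex)
  ultimately have "convex_on UNIV (\<lambda>H :: real ^ 2 ^ 2. \<phi> (singular_value 1 H) + \<phi> (singular_value 2 H))"
    by (intro convex_on_singular_values)
  then have "convex_on UNIV
      (\<lambda>H :: real ^ 2 ^ 2. 1 / \<rho> * (\<phi> (singular_value 1 H) + \<phi> (singular_value 2 H)))"
    using assms by (intro convex_on_cmul) auto
  moreover have "1 / \<rho> * (\<phi> (singular_value 1 H) + \<phi> (singular_value 2 H))
      = r H + 1 / \<rho> / 2 * (norm H)\<^sup>2" for H
  proof -
    \<comment> \<open>This identity turns the quadratic terms of \<phi> into the squared Frobenius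
      norm.\<close>
    have "(singular_value 1 H)\<^sup>2 + (singular_value 2 H)\<^sup>2 = (norm H)\<^sup>2"
      unfolding singular_value_2 power2_norm_eq_conformal_parts
      by (simp add: power_divide power2_sum power2_diff field_simps)
    then have "\<phi> (singular_value 1 H) + \<phi> (singular_value 2 H) = \<rho> * r H + (norm H)\<^sup>2 / 2"
      by (simp add: \<phi>_def assms(5) algebra_simps flip: add_divide_distrib)
    then show ?thesis
      using assms(1) by (simp add: field_simps)
  qed
  ultimately show "convex_on UNIV (\<lambda>H. r H + 1 / \<rho> / 2 * (norm H)\<^sup>2)"
    by simp
qed

end
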